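(* Every $f\in\mathcal{F}$ satisfies $3-n\le f(n)\le n-1$ for $n>2$, and these bounds are sharp for every $n>2$, in the following sense. Fix $n>2$. (Upper bound) Define $f_u(i)=i-1$ for $i=1,\ldots,n$. Then $f_u\in\mathcal{F}_n$ and $f_u(n)=n-1$. (Lower bound) Define the sequence $f_l$ of length $n$ by $$f_l:=(\underbrace{0,\ldots,0}_{n-3\text{ zeroes}},\, n-3,\, 1,\, 3-n).$$ Then $f_l\in\mathcal{F}_n$ and $f_l(n)=3-n$.
   Context: All sequences are integer sequences indexed from 1. $\mathcal{Q}$ is the set of all infinite sequences $(q(n))_{n\in\mathbb{N}}$ with $1\le q(n)\le n$ for all $n\in\mathbb{N}$. For $q\in\mathcal{Q}$, $F(q)$ denotes the sequence $f$ with $f(1)=0$ and $f(n)=q(n)-q(n-q(n-1))$ for $n>1$. $\mathcal{F}:=\{F(q): q\in\mathcal{Q}\}$, and $\mathcal{F}_n$ is the set of length-$n$ sequences formed by the first $n$ terms of the sequences in $\mathcal{F}$. *)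

theory Defs
  imports Main
begin

(* An infinite integer sequence indexed from 1 is a function nat => int whose value at
   index 0 is irrelevant; nothing below depends on q 0. *)

definition Q_seqs :: "(nat \<Rightarrow> int) set" where
  "Q_seqs = {q. \<forall>n\<ge>1. 1 \<le> q n \<and> q n \<le> int n}"

(* For q in Q_seqs and n > 1 we have 1 <= q (n - 1) <= n - 1, so neither nat nor the
   subtraction on nat truncates and the index n - nat (q (n - 1)) lies in {1..n - 1}.
   The value at the unused index 0 is set to 0. *)
definition F :: "(nat \<Rightarrow> int) \<Rightarrow> nat \<Rightarrow> int" where
  "F q n = (if n \<le> 1 then 0 else q n - q (n - nat (q (n - 1))))"

definition F_seqs :: "(nat \<Rightarrow> int) set" where
  "F_seqs = {F q | q. q \<in> Q_seqs}"

(* A finite sequence of length n is a list of length n: its i-th term (1 <= i <= n) is the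
   list entry at position i - 1. *)
definition F_prefixes :: "nat \<Rightarrow> int list set" where
  "F_prefixes n = {map f [1..<n + 1] | f. f \<in> F_seqs}"

definition f_u :: "nat \<Rightarrow> int list" where
  "f_u n = map (\<lambda>i. int i - 1) [1..<n + 1]"

definition f_l :: "nat \<Rightarrow> int list" where
  "f_l n = replicate (n - 3) 0 @ [int n - 3, 1, 3 - int n]"

end

theory Submission imports Defs begin

text \<open>
  The upper bound combines \<open>q n \<le> n\<close> with positivity of the subtracted term. For the
  lower bound, the term subtracted from \<open>q n\<close> has index \<open>n - q (n - 1)\<close> and hence value at
  most \<open>n - q (n - 1)\<close>. This gives \<open>F q n \<ge> 1 - n + q (n - 1)\<close>, which suffices as soon as
  \<open>q (n - 1) \<ge> 2\<close>. In the remaining case \<open>q (n - 1) = 1\<close> the subtracted term is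
  \<open>q (n - 1) = 1\<close> itself, so \<open>F q n \<ge> 0 \<ge> 3 - n\<close>.

  For \<open>n > 3\<close>, equality in the lower bound forces \<open>q n = 1\<close>, \<open>q (n - 1) = 2\<close> and \<open>q (n - 2) = n - 2\<close>;
  filling up with ones produces the sequence that witnesses sharpness. For the upper
  bound the identity sequence is a witness, because every term then subtracts \<open>q 1 = 1\<close>.
\<close>

lemma Q_seqs_bounds:
  assumes "q \<in> Q_seqs" "1 \<le> n"
  shows "1 \<le> q n" "q n \<le> int n"
  using assms by (auto simp: Q_seqs_def)

lemma F_bounds:
  assumes q: "q \<in> Q_seqs" and n: "2 < n"
  shows "3 - int n \<le> F q n" "F q n \<le> int n - 1"
proof -
  define m where "m = n - nat (q (n - 1))"
  have prev: "1 \<le> q (n - 1)" "q (n - 1) \<le> int n - 1"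
    using Q_seqs_bounds[OF q, of "n - 1"] n by auto
  have m: "1 \<le> m" "int m = int n - q (n - 1)"
    unfolding m_def using prev n by linarith+
  have F: "F q n = q n - q m"
    using n by (simp add: F_def m_def)
  note cur = Q_seqs_bounds[OF q, of n] and ref = Q_seqs_bounds[OF q m(1)]
  show "F q n \<le> int n - 1"
    using F cur ref n by simp
  show "3 - int n \<le> F q n"
  proof (cases "q (n - 1) = 1")
    case True
    then have "q m = 1" by (simp add: m_def)
    then show ?thesis using F cur n by simp
  next
    case False
    then show ?thesis using F cur ref prev m n by simp
  qed
qed

lemma F_prefixesI:
  assumes "q \<in> Q_seqs" "length xs = n" "\<And>i. i < n \<Longrightarrow> xs ! i = F q (Suc i)"
  shows "xs \<in> F_prefixes n"
proof -
  have "xs = map (F q) [1..<n + 1]"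
    by (rule nth_equalityI) (use assms in \<open>auto simp del: upt_Suc\<close>)
  with assms(1) show ?thesis
    by (auto simp: F_prefixes_def F_seqs_def)
qed

lemma f_u_in_F_prefixes: "f_u n \<in> F_prefixes n"
proof (rule F_prefixesI)
  show "int \<in> Q_seqs" by (simp add: Q_seqs_def)
  show "length (f_u n) = n" by (simp add: f_u_def)
  show "f_u n ! i = F int (Suc i)" if "i < n" for i
    using that by (simp add: f_u_def F_def del: upt_Suc)
qed

lemma f_l_in_F_prefixes:
  assumes n: "2 < n"
  shows "f_l n \<in> F_prefixes n"
proof -
  define q :: "nat \<Rightarrow> int" where
    "q i = (if i = n - 2 then int n - 2 else if i = n - 1 then 2 else 1)" for i
  \<comment> \<open>For \<open>n = 3\<close> the index \<open>n - 2\<close> is \<open>1\<close>; the first clause then agrees with \<open>q 1 = 1\<close>.\<close>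
  have q1: "q 1 = 1" using n by (auto simp: q_def)
  show ?thesis
  proof (rule F_prefixesI)
    show "q \<in> Q_seqs" using n by (auto simp: Q_seqs_def q_def)
    show "length (f_l n) = n" using n by (simp add: f_l_def)
    show "f_l n ! i = F q (Suc i)" if i: "i < n" for i
    proof -
      consider "i < n - 3" | "i = n - 3" | "i = n - 2" | "i = n - 1"
        using i by linarith
      then show ?thesis
      proof cases
        case 1
        then have "q (Suc i) = 1" "q i = 1" by (auto simp: q_def)
        then show ?thesis using 1 by (simp add: f_l_def F_def nth_append)
      next
        case 2
        show ?thesis
        proof (cases "n = 3")
          case True
          then show ?thesis using 2 by (simp add: f_l_def F_def)
        next
          case False
          then have "q i = 1" "q (Suc i) = int n - 2" using 2 n by (auto simp: q_def)
          then show ?thesis using 2 False n by (simp add: f_l_def F_def nth_append)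
        qed
      next
        case 3
        then have "q i = int n - 2" "q (Suc i) = 2" using n by (auto simp: q_def)
        moreover have "Suc i - nat (int n - 2) = 1" using 3 n by linarith
        moreover have "i - (n - 3) = 1" "\<not> i < n - 3" using 3 n by linarith+
        ultimately show ?thesis using 3 n q1 by (simp add: f_l_def F_def nth_append)
      next
        case 4
        then have "q i = 2" "q (Suc i) = 1" "q (Suc i - 2) = int n - 2"
          using n by (auto simp: q_def)
        moreover have "i - (n - 3) = 2" "\<not> i < n - 3" using 4 n by linarith+
        ultimately show ?thesis using 4 n by (simp add: f_l_def F_def nth_append)
      qed
    qed
  qed
qed

theorem lemma2p6:
  "(\<forall>f \<in> F_seqs. \<forall>n > 2. 3 - int n \<le> f n \<and> f n \<le> int n - 1) \<and>
   (\<forall>n > 2. f_u n \<in> F_prefixes n \<and> f_u n ! (n - 1) = int n - 1) \<and>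
   (\<forall>n > 2. f_l n \<in> F_prefixes n \<and> f_l n ! (n - 1) = 3 - int n)"
proof (intro conjI ballI allI impI)
  fix f and n :: nat
  assume "f \<in> F_seqs" and n: "2 < n"
  then obtain q where "q \<in> Q_seqs" "f = F q" by (auto simp: F_seqs_def)
  then show "3 - int n \<le> f n" "f n \<le> int n - 1" using F_bounds n by auto
next
  fix n :: nat
  assume n: "2 < n"
  show "f_u n \<in> F_prefixes n" by (rule f_u_in_F_prefixes)
  show "f_u n ! (n - 1) = int n - 1" using n by (simp add: f_u_def del: upt_Suc)
  show "f_l n \<in> F_prefixes n" using n by (rule f_l_in_F_prefixes)
  have "n - 1 - (n - 3) = 2" "\<not> n - 1 < n - 3" using n by linarith+
  then show "f_l n ! (n - 1) = 3 - int n" by (simp add: f_l_def nth_append)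
qed

end
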